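(* Let $\Gamma$ be a splice diagram with $n$ leaves satisfying the edge determinant and semigroup conditions and let $\mathcal{S}(\Gamma)$ be a splice type system for $\Gamma$. Let $\tau$ be a positive-dimensional proper face of $\mathbb{R}_{\ge0}^n$, let $\lambda\in L_\tau$, and let $v$ be the unique node of $\Gamma$ adjacent to $\lambda$. Then: (1) if $\dim\tau=1$, then $\mathrm{Trop}^+(\mathcal{S}(\Gamma),\tau)\subseteq\mathbb{R}_{>0}\,\pi_\tau(w_v)$; (2) if $\dim\tau\ge2$, then $\mathrm{Trop}^+(\mathcal{S}(\Gamma),\tau)=\emptyset$.
   Context: A splice diagram is a finite tree $\Gamma$ with at least one vertex of valency $\geq3$ and no vertex of valency $2$; vertices of valency $1$ are leaves, others nodes; $\delta_v$ is the valency of $v$. For each node $v$ and edge $e$ at $v$ a positive integer weight $d_{v,e}$ is given; $d_v=\prod_{e\ni v}d_{v,e}$; $d_{v,u}$ is the weight at $v$ of the edge toward $u$. For distinct vertices $u,v$, $\ell_{u,v}$ is the product of all $d_{w,e}$ with $w$ a node on $[u,v]$ and $e$ an edge at $w$ not in $[u,v]$; $\ell_{v,v}=d_v$. Edge determinant condition: $d_{u,v}d_{v,u}>\ell_{u,v}$ for every edge between nodes. Semigroup condition: for each node $v$ and edge $e$ at $v$, $d_v\in\sum_{\mu\in L(v,e)}\mathbb{N}\ell_{v,\mu}$, $L(v,e)$ the leaves $\mu$ with $e\subseteq[v,\mu]$. Variables $z_\mu$ and standard basis vectors $w_\mu$ of $\mathbb{R}^n$ are indexed by leaves; $w_u=\sum_\mu\ell_{u,\mu}w_\mu$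 for nodes $u$. Fix $\alpha_{v,e,\mu}\in\mathbb{N}$ with $d_v=\sum\alpha_{v,e,\mu}\ell_{v,\mu}$, $z^{m_{v,e}}=\prod z_\mu^{\alpha_{v,e,\mu}}$. A splice type system is a family $F_{v,i}=f_{v,i}+g_{v,i}\in\mathbb{C}\{z_\mu\}$ ($v$ node, $1\le i\le\delta_v-2$), $f_{v,i}=\sum_{e\ni v}c_{v,e,i}z^{m_{v,e}}$ with all maximal minors of $(c_{v,e,i})_{e,i}$ nonzero, $g_{v,i}$ convergent with every exponent $m$ satisfying $w_v\cdot m>d_v$ and $w_u\cdot m>\ell_{u,v}$ for nodes $u\neq v$. For a face $\tau$ of dimension $k$, $L_\tau$ is the set of leaves $\mu$ with $w_\mu$ a ray of $\tau$, and $\pi_\tau:\mathbb{R}^n\to\mathbb{R}^{n-k}$ is the projection forgetting the coordinates indexed by $L_\tau$. The $\tau$-truncation $F^\tau$ of a series $F$ is obtained by setting $z_\mu=0$ for all $\mu\in L_\tau$, viewed in $\mathcal{O}_\tau=\mathbb{C}\{z_\mu:\mu\notin L_\tau\}$. Let $J_\tau\subseteq\mathcal{O}_\tau$ be generated by the $F_{v,i}^\tau$. For $w\in\mathbb{R}_{\ge0}^{n-k}$, $\mathrm{in}_w(f)$ is the sum of terms of $f$ of minimal $w$-weight, and $\mathrm{in}_w(J_\tau)$ the ideal of $\mathcal{O}_\tau$ generated by all $\mathrm{in}_w(f)$, $f\in J_\tau$. Then $\mathrm{Trop}^+(\mathcal{S}(\Gamma),\tau)$ is the set of $w\in\mathbb{R}_{>0}^{n-k}$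 such that $\mathrm{in}_w(J_\tau)$ contains no monomial (the positive local tropicalization of the intersection of the germ with the torus of the coordinate subspace $\{z_\mu=0,\ \mu\in L_\tau\}$). *)

theory Defs
  imports Complex_Main "Jordan_Normal_Form.Determinant"
begin

text \<open>A splice diagram is given by a finite vertex set V of type 'v and a
symmetric irreflexive adjacency relation adj on V.  Edges at a vertex w are
identified with the neighbours x of w (edge = the set {w,x}).\<close>

definition nbrs :: "('v \<Rightarrow> 'v \<Rightarrow> bool) \<Rightarrow> 'v \<Rightarrow> 'v set" where
  "nbrs adj v = {x. adj v x}"

definition valency :: "('v \<Rightarrow> 'v \<Rightarrow> bool) \<Rightarrow> 'v \<Rightarrow> nat" where
  "valency adj v = card (nbrs adj v)"

definition leaves :: "'v set \<Rightarrow> ('v \<Rightarrow> 'v \<Rightarrow> bool) \<Rightarrow> 'v set" where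
  "leaves V adj = {v \<in> V. valency adj v = 1}"

definition nodes :: "'v set \<Rightarrow> ('v \<Rightarrow> 'v \<Rightarrow> bool) \<Rightarrow> 'v set" where
  "nodes V adj = {v \<in> V. valency adj v \<noteq> 1}"

definition is_path :: "('v \<Rightarrow> 'v \<Rightarrow> bool) \<Rightarrow> 'v \<Rightarrow> 'v \<Rightarrow> 'v list \<Rightarrow> bool" where
  "is_path adj u v p \<longleftrightarrow> p \<noteq> [] \<and> hd p = u \<and> last p = v \<and> distinct p \<and>
     (\<forall>i. Suc i < length p \<longrightarrow> adj (p ! i) (p ! Suc i))"

text \<open>Vertices and edges of the (unique, in a tree) geodesic [u,v].\<close>
definition path_verts :: "('v \<Rightarrow> 'v \<Rightarrow> bool) \<Rightarrow> 'v \<Rightarrow> 'v \<Rightarrow> 'v set" where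
  "path_verts adj u v = {w. \<exists>p. is_path adj u v p \<and> w \<in> set p}"

definition path_edges :: "('v \<Rightarrow> 'v \<Rightarrow> bool) \<Rightarrow> 'v \<Rightarrow> 'v \<Rightarrow> 'v set set" where
  "path_edges adj u v =
     {e. \<exists>p i. is_path adj u v p \<and> Suc i < length p \<and> e = {p ! i, p ! Suc i}}"

definition is_tree :: "'v set \<Rightarrow> ('v \<Rightarrow> 'v \<Rightarrow> bool) \<Rightarrow> bool" where
  "is_tree V adj \<longleftrightarrow> finite V \<and> V \<noteq> {} \<and>
     (\<forall>u v. adj u v \<longrightarrow> u \<in> V \<and> v \<in> V \<and> u \<noteq> v \<and> adj v u) \<and>
     (\<forall>u\<in>V. \<forall>v\<in>V. \<exists>p. is_path adj u v p) \<and>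
     card {{u, v} | u v. adj u v} + 1 = card V"

definition splice_diagram :: "'v set \<Rightarrow> ('v \<Rightarrow> 'v \<Rightarrow> bool) \<Rightarrow> bool" where
  "splice_diagram V adj \<longleftrightarrow> is_tree V adj \<and> (\<exists>v\<in>V. valency adj v \<ge> 3) \<and>
     (\<forall>v\<in>V. valency adj v \<noteq> 2)"

text \<open>Weights: d v x is the weight d_{v,e} at the node v of the edge e = {v,x}.\<close>
definition weights_ok :: "'v set \<Rightarrow> ('v \<Rightarrow> 'v \<Rightarrow> bool) \<Rightarrow> ('v \<Rightarrow> 'v \<Rightarrow> nat) \<Rightarrow> bool" where
  "weights_ok V adj d \<longleftrightarrow> (\<forall>v\<in>nodes V adj. \<forall>x\<in>nbrs adj v. d v x > 0)"

definition dv :: "('v \<Rightarrow> 'v \<Rightarrow> bool) \<Rightarrow> ('v \<Rightarrow> 'v \<Rightarrow> nat) \<Rightarrow> 'v \<Rightarrow> nat" where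
  "dv adj d v = (\<Prod>x\<in>nbrs adj v. d v x)"

definition ell :: "'v set \<Rightarrow> ('v \<Rightarrow> 'v \<Rightarrow> bool) \<Rightarrow> ('v \<Rightarrow> 'v \<Rightarrow> nat) \<Rightarrow> 'v \<Rightarrow> 'v \<Rightarrow> nat" where
  "ell V adj d u v =
     (if u = v then dv adj d v
      else (\<Prod>w\<in>path_verts adj u v \<inter> nodes V adj.
              \<Prod>x\<in>{x. adj w x \<and> {w, x} \<notin> path_edges adj u v}. d w x))"

definition edge_determinant :: "'v set \<Rightarrow> ('v \<Rightarrow> 'v \<Rightarrow> bool) \<Rightarrow> ('v \<Rightarrow> 'v \<Rightarrow> nat) \<Rightarrow> bool" where
  "edge_determinant V adj d \<longleftrightarrow>
     (\<forall>u\<in>nodes V adj. \<forall>v\<in>nodes V adj. adj u v \<longrightarrow> d u v * d v u > ell V adj d u v)"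

definition Lset :: "'v set \<Rightarrow> ('v \<Rightarrow> 'v \<Rightarrow> bool) \<Rightarrow> 'v \<Rightarrow> 'v \<Rightarrow> 'v set" where
  "Lset V adj v x = {mu \<in> leaves V adj. {v, x} \<in> path_edges adj v mu}"

definition semigroup_cond :: "'v set \<Rightarrow> ('v \<Rightarrow> 'v \<Rightarrow> bool) \<Rightarrow> ('v \<Rightarrow> 'v \<Rightarrow> nat) \<Rightarrow> bool" where
  "semigroup_cond V adj d \<longleftrightarrow>
     (\<forall>v\<in>nodes V adj. \<forall>x\<in>nbrs adj v. \<exists>a :: 'v \<Rightarrow> nat.
        dv adj d v = (\<Sum>mu\<in>Lset V adj v x. a mu * ell V adj d v mu))"

text \<open>A power series in the variables z_mu (mu in a finite set S of leaves) is
represented by its coefficient function on exponent vectors 'v => nat that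
vanish outside S.\<close>

type_synonym 'v pser = "('v \<Rightarrow> nat) \<Rightarrow> complex"

definition expos :: "'v set \<Rightarrow> ('v \<Rightarrow> nat) set" where
  "expos S = {m. \<forall>x. x \<notin> S \<longrightarrow> m x = 0}"

text \<open>The ring C{z_mu : mu in S}: series whose coefficients admit a geometric
bound |c_m| <= C R^|m| (equivalently, convergent on a polydisc).\<close>
definition conv_ring :: "'v set \<Rightarrow> 'v pser set" where
  "conv_ring S = {f. (\<forall>m. f m \<noteq> 0 \<longrightarrow> m \<in> expos S) \<and>
      (\<exists>C R :: real. \<forall>m \<in> expos S. norm (f m) \<le> C * R ^ (\<Sum>x\<in>S. m x))}"

definition ps_mult :: "'v pser \<Rightarrow> 'v pser \<Rightarrow> 'v pser" where
  "ps_mult f g = (\<lambda>m. \<Sum>a\<in>{a. \<forall>x. a x \<le> m x}. f a * g (\<lambda>x. m x - a x))"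

definition monom :: "('v \<Rightarrow> nat) \<Rightarrow> 'v pser" where
  "monom a = (\<lambda>m. if m = a then 1 else 0)"

definition ideal_gen :: "'v pser set \<Rightarrow> 'v pser set \<Rightarrow> 'v pser set" where
  "ideal_gen R G = {f. \<exists>(k::nat) h g. (\<forall>i<k. h i \<in> R \<and> g i \<in> G) \<and>
      f = (\<lambda>m. \<Sum>i<k. ps_mult (h i) (g i) m)}"

definition trunc :: "'v set \<Rightarrow> 'v pser \<Rightarrow> 'v pser" where
  "trunc T f = (\<lambda>m. if \<forall>mu\<in>T. m mu = 0 then f m else 0)"

definition wdot :: "'v set \<Rightarrow> ('v \<Rightarrow> real) \<Rightarrow> ('v \<Rightarrow> nat) \<Rightarrow> real" where
  "wdot S w m = (\<Sum>mu\<in>S. w mu * real (m mu))"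

definition initial :: "'v set \<Rightarrow> ('v \<Rightarrow> real) \<Rightarrow> 'v pser \<Rightarrow> 'v pser" where
  "initial S w f = (\<lambda>m. if f m \<noteq> 0 \<and> (\<forall>m'. f m' \<noteq> 0 \<longrightarrow> wdot S w m \<le> wdot S w m')
                        then f m else 0)"

definition node_weight :: "'v set \<Rightarrow> ('v \<Rightarrow> 'v \<Rightarrow> bool) \<Rightarrow> ('v \<Rightarrow> 'v \<Rightarrow> nat) \<Rightarrow> 'v \<Rightarrow> ('v \<Rightarrow> nat) \<Rightarrow> nat" where
  "node_weight V adj d u m = (\<Sum>mu\<in>leaves V adj. ell V adj d u mu * m mu)"

text \<open>alpha v x : exponent vector m_{v,e} for e = {v,x};
 c v x i : coefficient c_{v,e,i}; g v i and F v i for 1 <= i <= valency v - 2.\<close>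
definition splice_type_system ::
  "'v set \<Rightarrow> ('v \<Rightarrow> 'v \<Rightarrow> bool) \<Rightarrow> ('v \<Rightarrow> 'v \<Rightarrow> nat)
   \<Rightarrow> ('v \<Rightarrow> 'v \<Rightarrow> 'v \<Rightarrow> nat) \<Rightarrow> ('v \<Rightarrow> 'v \<Rightarrow> nat \<Rightarrow> complex)
   \<Rightarrow> ('v \<Rightarrow> nat \<Rightarrow> 'v pser) \<Rightarrow> ('v \<Rightarrow> nat \<Rightarrow> 'v pser) \<Rightarrow> bool" where
  "splice_type_system V adj d alpha c g F \<longleftrightarrow>
    (\<forall>v\<in>nodes V adj. \<forall>x\<in>nbrs adj v.
       (\<forall>mu. alpha v x mu \<noteq> 0 \<longrightarrow> mu \<in> Lset V adj v x) \<and>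
       dv adj d v = (\<Sum>mu\<in>Lset V adj v x. alpha v x mu * ell V adj d v mu)) \<and>
    (\<forall>v\<in>nodes V adj. \<forall>S b. S \<subseteq> nbrs adj v \<and> card S = valency adj v - 2 \<and>
       bij_betw b {0..<valency adj v - 2} S \<longrightarrow>
       det (mat (valency adj v - 2) (valency adj v - 2) (\<lambda>(i, j). c v (b i) (Suc j))) \<noteq> 0) \<and>
    (\<forall>v\<in>nodes V adj. \<forall>i\<in>{1..valency adj v - 2}.
       g v i \<in> conv_ring (leaves V adj) \<and>
       (\<forall>m. g v i m \<noteq> 0 \<longrightarrow>
          node_weight V adj d v m > dv adj d v \<and>
          (\<forall>u\<in>nodes V adj. u \<noteq> v \<longrightarrow> node_weight V adj d u m > ell V adj d u v)) \<and>
       F v i = (\<lambda>m. (\<Sum>x\<in>nbrs adj v. c v x i * monom (alpha v x) m) + g v i m))"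

text \<open>A face tau of the orthant is encoded by L_tau = T (a set of leaves);
dim tau = card T.  Vectors of R^(n-k) are functions on the leaves outside T
(extended by 0).\<close>

definition J_tau :: "'v set \<Rightarrow> ('v \<Rightarrow> 'v \<Rightarrow> bool) \<Rightarrow> ('v \<Rightarrow> nat \<Rightarrow> 'v pser) \<Rightarrow> 'v set \<Rightarrow> 'v pser set" where
  "J_tau V adj F T = ideal_gen (conv_ring (leaves V adj - T))
     {trunc T (F v i) | v i. v \<in> nodes V adj \<and> i \<in> {1..valency adj v - 2}}"

definition trop_pos :: "'v set \<Rightarrow> ('v \<Rightarrow> 'v \<Rightarrow> bool) \<Rightarrow> ('v \<Rightarrow> nat \<Rightarrow> 'v pser) \<Rightarrow> 'v set \<Rightarrow> ('v \<Rightarrow> real) set" where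
  "trop_pos V adj F T =
    {w. (\<forall>mu. (mu \<in> leaves V adj - T \<longrightarrow> w mu > 0) \<and> (mu \<notin> leaves V adj - T \<longrightarrow> w mu = 0)) \<and>
        (\<forall>a\<in>expos (leaves V adj - T).
           monom a \<notin> ideal_gen (conv_ring (leaves V adj - T))
                        (initial (leaves V adj - T) w ` J_tau V adj F T))}"

definition proj_wnode :: "'v set \<Rightarrow> ('v \<Rightarrow> 'v \<Rightarrow> bool) \<Rightarrow> ('v \<Rightarrow> 'v \<Rightarrow> nat) \<Rightarrow> 'v set \<Rightarrow> 'v \<Rightarrow> 'v \<Rightarrow> real" where
  "proj_wnode V adj d T u = (\<lambda>mu. if mu \<in> leaves V adj - T then real (ell V adj d u mu) else 0)"

end

theory Submission
  imports Defs
begin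

text \<open>Put \<open>S = leaves V adj - T\<close>. For a node \<open>u\<close> let \<open>Z\<^sub>u \<subseteq> S\<close> be the set of leaves minimising
  \<open>w\<^sub>\<mu> / \<ell>\<^sub>u\<^sub>,\<^sub>\<mu>\<close>, with minimum \<open>t\<close>. Then \<open>w \<ge> t w\<^sub>u\<close> on \<open>S\<close>, so every term of \<open>g(u,i)\<close> that avoids
  \<open>T\<close> has weight above \<open>t d\<^sub>u\<close>, and the admissible monomial of an edge at \<open>u\<close> has weight \<open>t d\<^sub>u\<close>
  exactly when its support lies in \<open>Z\<^sub>u\<close>. If this holds for some edge but fails for two, linear
  algebra produces an element of the ideal whose initial form is a monomial. Hence for \<open>w\<close> in the
  tropicalization, one such edge forces all edges but at most one to be such.

  By the edge determinant condition, \<open>Z\<^sub>x\<close> meeting the branch of \<open>x\<close> through \<open>y\<close> makes \<open>Z\<^sub>y\<close> avoid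
  the branch of \<open>y\<close> through \<open>x\<close>. Induction from the leaves inwards then shows that whenever \<open>Z\<^sub>x\<close>
  avoids one branch at \<open>x\<close>, it contains every leaf of all the others. At the node \<open>v\<close>, the branch
  \<open>{\<lambda>}\<close> is avoided because \<open>\<lambda> \<in> T\<close>; so \<open>Z\<^sub>v\<close> is the set of all leaves other than \<open>\<lambda>\<close>, which gives
  both \<open>T = {\<lambda>}\<close> and \<open>w = t \<pi>\<^sub>\<tau>(w\<^sub>v)\<close>.\<close>

section \<open>Paths in trees\<close>

lemma is_path_successively:
  "is_path adj u v p \<longleftrightarrow> p \<noteq> [] \<and> hd p = u \<and> last p = v \<and> distinct p \<and> successively adj p"
  by (simp add: is_path_def successively_conv_nth)

lemma is_path_Cons:
  "is_path adj u v (a # q) \<longleftrightarrow>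
     a = u \<and> (if q = [] then u = v else u \<notin> set q \<and> adj u (hd q) \<and> is_path adj (hd q) v q)"
  by (cases q) (auto simp: is_path_successively)

text \<open>Reachability in the graph without \<open>x\<close> can be composed and reversed freely,
  whereas gluing two simple paths need not give a simple path. The uniqueness of geodesics relies on
  this form.\<close>

lemma is_path_rtranclp_avoiding:
  assumes "is_path adj u v p" and "x \<notin> set p"
  shows "(\<lambda>a b. adj a b \<and> a \<noteq> x \<and> b \<noteq> x)\<^sup>*\<^sup>* u v"
  using assms
proof (induction p arbitrary: u)
  case Nil
  then show ?case by (simp add: is_path_def)
next
  case (Cons a q)
  show ?case
  proof (cases "q = []")
    case True
    then show ?thesis using Cons.prems by (simp add: is_path_Cons)
  next
    case False
    then have "adj u (hd q)" "is_path adj (hd q) v q" "u \<noteq> x" "hd q \<noteq> x"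
      using Cons.prems by (auto simp: is_path_Cons)
    then show ?thesis
      using Cons.IH[of "hd q"] Cons.prems(2)
      by (auto intro: converse_rtranclp_into_rtranclp)
  qed
qed

lemma is_path_rtranclp:
  assumes "is_path adj u v p" shows "adj\<^sup>*\<^sup>* u v"
  using assms
proof (induction p arbitrary: u)
  case Nil
  then show ?case by (simp add: is_path_def)
next
  case (Cons a q)
  then show ?case
    by (auto simp: is_path_Cons split: if_splits intro: converse_rtranclp_into_rtranclp)
qed

lemma is_path_prefix:
  assumes "is_path adj u v p" and "x \<in> set p"
  obtains q where "is_path adj u x q" "set q \<subseteq> set p"
proof -
  obtain p1 p2 where p: "p = (p1 @ [x]) @ p2"
    using split_list[OF assms(2)] by auto
  have "hd (p1 @ [x]) = hd p" by (simp add: p hd_append)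
  then have "is_path adj u x (p1 @ [x])"
    using assms(1) unfolding is_path_successively p successively_append_iff by auto
  then show ?thesis using that[of "p1 @ [x]"] by (auto simp: p)
qed

text \<open>Every vertex other than the root \<open>r\<close> has a neighbour \<open>q z\<close>
  strictly closer to \<open>r\<close> in breadth-first distance. Sending \<open>z\<close> to the
  edge \<open>{q z, z}\<close> is injective: if two different vertices had the same edge, each would
  be closer to \<open>r\<close> than the other.\<close>

lemma card_le_Suc_card_edges:
  assumes "finite V" and "r \<in> V"
    and adj: "\<And>u v. adj u v \<Longrightarrow> u \<in> V \<and> v \<in> V"
    and conn: "\<And>z. z \<in> V \<Longrightarrow> adj\<^sup>*\<^sup>* r z"
  shows "card V \<le> card {{u, v} | u v. adj u v} + 1"
proof -
  define dist where "dist z = (LEAST n. (adj ^^ n) r z)" for z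
  have dist: "(adj ^^ dist z) r z" if "z \<in> V" for z
    using rtranclp_imp_relpowp[OF conn[OF that]] unfolding dist_def by (auto intro: LeastI)
  have "\<exists>q. adj q z \<and> dist q < dist z" if z: "z \<in> V - {r}" for z
  proof (cases "dist z")
    case 0
    then show ?thesis using dist[of z] z by simp
  next
    case (Suc n)
    then obtain q where "(adj ^^ n) r q" "adj q z" using dist[of z] z by auto
    moreover from this(1) have "dist q \<le> n" unfolding dist_def by (rule Least_le)
    ultimately show ?thesis using Suc by auto
  qed
  then obtain q where q: "\<And>z. z \<in> V - {r} \<Longrightarrow> adj (q z) z \<and> dist (q z) < dist z" by metis
  have inj: "inj_on (\<lambda>z. {q z, z}) (V - {r})"
  proof (rule inj_onI)
    fix a b assume "a \<in> V - {r}" "b \<in> V - {r}" "{q a, a} = {q b, b}"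
    then show "a = b" using q[of a] q[of b] by (auto simp: doubleton_eq_iff)
  qed
  have "finite {{u, v} | u v. adj u v}"
    by (rule finite_subset[of _ "Pow V"]) (use adj \<open>finite V\<close> in auto)
  moreover have "(\<lambda>z. {q z, z}) ` (V - {r}) \<subseteq> {{u, v} | u v. adj u v}" using q by blast
  ultimately have "card (V - {r}) \<le> card {{u, v} | u v. adj u v}"
    using card_inj_on_le[OF inj] by blast
  then show ?thesis using \<open>finite V\<close> \<open>r \<in> V\<close> by (simp add: card_Diff_singleton)
qed

lemma consecutive_pairs_Cons:
  assumes "q \<noteq> []"
  shows "{{(x # q) ! i, (x # q) ! Suc i} | i. Suc i < length (x # q)} =
    insert {x, q ! 0} {{q ! i, q ! Suc i} | i. Suc i < length q}" (is "?A = ?B")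
proof
  show "?A \<subseteq> ?B"
  proof
    fix e assume "e \<in> ?A"
    then obtain i where "e = {(x # q) ! i, (x # q) ! Suc i}" "Suc i < length (x # q)" by blast
    then show "e \<in> ?B" by (cases i) auto
  qed
  have "{x, q ! 0} \<in> ?A"
    using assms by (intro CollectI exI[of _ 0]) auto
  moreover have "{q ! i, q ! Suc i} \<in> ?A" if "Suc i < length q" for i
    using that by (intro CollectI exI[of _ "Suc i"]) auto
  ultimately show "?B \<subseteq> ?A" by blast
qed

text \<open>For adjacent \<open>x\<close> and \<open>y\<close> in a tree this is the component
  containing \<open>y\<close> after \<open>x\<close> is deleted. Its leaves form the set L(x,e) for
  the edge e joining \<open>x\<close> and \<open>y\<close>.\<close>

definition branch :: "('v \<Rightarrow> 'v \<Rightarrow> bool) \<Rightarrow> 'v \<Rightarrow> 'v \<Rightarrow> 'v set" where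
  "branch adj x y = {z. \<exists>q. is_path adj y z q \<and> x \<notin> set q}"

section \<open>Bridges and unique geodesics in a finite tree\<close>

locale finite_tree =
  fixes V :: "'v set" and adj :: "'v \<Rightarrow> 'v \<Rightarrow> bool"
  assumes tree: "is_tree V adj"
begin

lemma finite_V: "finite V"
  using tree by (simp add: is_tree_def)

lemma adjD: "adj u v \<Longrightarrow> u \<in> V \<and> v \<in> V \<and> u \<noteq> v \<and> adj v u"
  using tree by (simp add: is_tree_def)

lemma adj_commute: "adj u v \<longleftrightarrow> adj v u"
  using adjD by blast

lemma finite_nbrs: "finite (nbrs adj x)"
  by (rule finite_subset[OF _ finite_V]) (auto simp: nbrs_def dest: adjD)

lemma path_exists: "u \<in> V \<Longrightarrow> v \<in> V \<Longrightarrow> \<exists>p. is_path adj u v p"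
  using tree by (simp add: is_tree_def)

text \<open>Deleting an edge leaves too few edges for a connected graph.\<close>

lemma edge_is_bridge:
  assumes xy: "adj x y"
  shows "\<not> (\<lambda>a b. adj a b \<and> {a, b} \<noteq> {x, y})\<^sup>*\<^sup>* x y"
proof
  let ?R = "\<lambda>a b. adj a b \<and> {a, b} \<noteq> {x, y}"
  assume conn: "?R\<^sup>*\<^sup>* x y"
  have "symp ?R" by (rule sympI) (use adj_commute in \<open>auto simp: insert_commute\<close>)
  then have "symp ?R\<^sup>*\<^sup>*" by (rule symp_rtranclp)
  \<comment> \<open>The assumed detour replaces every use of the edge \<open>{x, y}\<close>, so the
    graph stays connected without it.\<close>
  then have "?R\<^sup>*\<^sup>* a b" if "adj a b" for a b
  proof (cases "{a, b} = {x, y}")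
    case True
    then show ?thesis using conn \<open>symp ?R\<^sup>*\<^sup>*\<close> by (auto simp: doubleton_eq_iff dest: sympD)
  qed (use that in auto)
  then have "adj\<^sup>*\<^sup>* \<le> ?R\<^sup>*\<^sup>*"
    using rtranclp_mono[of adj "?R\<^sup>*\<^sup>*"] by auto
  then have "?R\<^sup>*\<^sup>* x z" if "z \<in> V" for z
    using path_exists[of x z] is_path_rtranclp that adjD[OF xy] by fastforce
  then have le: "card V \<le> card {{u, v} | u v. ?R u v} + 1"
    using card_le_Suc_card_edges[of V x ?R] finite_V adjD xy by blast
  define E where "E = {{u, v} | u v. adj u v}"
  have "{{u, v} | u v. ?R u v} = E - {{x, y}}" unfolding E_def by auto
  with le have "card V \<le> card (E - {{x, y}}) + 1" by (simp only:)
  moreover have "{x, y} \<in> E" using xy by (auto simp: E_def)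
  moreover have "finite E"
    unfolding E_def by (rule finite_subset[of _ "Pow V"]) (use adjD finite_V in auto)
  moreover have "card E + 1 = card V"
    using tree by (simp only: is_tree_def E_def)
  ultimately show False using card_Suc_Diff1[of E "{x, y}"] by linarith
qed

text \<open>If two paths from \<open>u\<close> to \<open>v\<close> had different first edges, their
  tails, which avoid \<open>u\<close>, would connect \<open>hd q'\<close> to \<open>hd p'\<close>
  through \<open>v\<close>. Preceded by the edge from \<open>u\<close> to \<open>hd q'\<close>, this
  bypasses the edge from \<open>u\<close> to \<open>hd p'\<close>, contradicting that it is a
  bridge.\<close>

lemma path_unique:
  assumes "is_path adj u v p" and "is_path adj u v q"
  shows "p = q"
  using assms
proof (induction p arbitrary: u q)
  case Nil
  then show ?case by (simp add: is_path_def)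
next
  case (Cons a p')
  obtain q' where q: "q = u # q'"
    using Cons.prems(2) by (cases q) (auto simp: is_path_def)
  have a: "a = u" using Cons.prems(1) by (simp add: is_path_Cons)
  have ends: "r = []" if "is_path adj u u (u # r)" for r
    using that by (auto simp: is_path_def split: if_splits)
  show ?case
  proof (cases "p' = [] \<or> q' = []")
    case True
    then have "u = v" using Cons.prems q a by (auto simp: is_path_Cons)
    then have "p' = []" "q' = []" using ends[of p'] ends[of q'] Cons.prems q a by blast+
    then show ?thesis using q a by simp
  next
    case False
    then have p': "u \<notin> set p'" "adj u (hd p')" "is_path adj (hd p') v p'"
      and q': "u \<notin> set q'" "adj u (hd q')" "is_path adj (hd q') v q'"
      using Cons.prems q by (auto simp: is_path_Cons)
    have "hd p' = hd q'"
    proof (rule ccontr)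
      assume ne: "hd p' \<noteq> hd q'"
      let ?A = "\<lambda>a b. adj a b \<and> a \<noteq> u \<and> b \<noteq> u"
      let ?R = "\<lambda>a b. adj a b \<and> {a, b} \<noteq> {u, hd p'}"
      have "symp ?A" by (rule sympI) (use adj_commute in auto)
      then have "symp ?A\<^sup>*\<^sup>*" by (rule symp_rtranclp)
      then have "?A\<^sup>*\<^sup>* (hd q') (hd p')"
        using is_path_rtranclp_avoiding[OF p'(3,1)] is_path_rtranclp_avoiding[OF q'(3,1)]
        by (meson rtranclp_trans sympD)
      then have "?R\<^sup>*\<^sup>* (hd q') (hd p')"
        by (rule mono_rtranclp[rule_format, rotated]) (auto simp: doubleton_eq_iff)
      moreover have "?R u (hd q')" using q'(2) ne by (simp add: doubleton_eq_iff)
      ultimately have "?R\<^sup>*\<^sup>* u (hd p')" by (rule converse_rtranclp_into_rtranclp[rotated])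
      then show False by (rule notE[OF edge_is_bridge[OF p'(2)]])
    qed
    then show ?thesis using Cons.IH[of "hd p'" q'] p' q' q a by simp
  qed
qed

lemma path_verts_eq: "is_path adj u v p \<Longrightarrow> path_verts adj u v = set p"
  unfolding path_verts_def using path_unique by blast

lemma path_edges_eq:
  "is_path adj u v p \<Longrightarrow> path_edges adj u v = {{p ! i, p ! Suc i} | i. Suc i < length p}"
  unfolding path_edges_def using path_unique by blast

lemma path_extend:
  assumes "adj x y" and "is_path adj y z q" and "x \<notin> set q"
  shows "is_path adj x z (x # q)"
  using assms by (auto simp: is_path_Cons) (auto simp: is_path_def)

lemma path_edges_extend:
  assumes "adj x y" and q: "is_path adj y z q" and "x \<notin> set q"
  shows "path_edges adj x z = insert {x, y} (path_edges adj y z)"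
proof -
  have "q \<noteq> []" "q ! 0 = y" using q by (auto simp: is_path_def hd_conv_nth)
  then show ?thesis
    using consecutive_pairs_Cons[of q x]
    unfolding path_edges_eq[OF q] path_edges_eq[OF path_extend[OF assms]] by simp
qed

lemma path_edge_subset:
  assumes "is_path adj u v p" and "e \<in> path_edges adj u v"
  shows "e \<subseteq> set p"
  using assms by (auto simp: path_edges_eq)

section \<open>Branches at a vertex\<close>

lemma edge_in_path_iff_branch:
  assumes "adj x y"
  shows "{x, y} \<in> path_edges adj x z \<longleftrightarrow> z \<in> branch adj x y"
proof
  assume "{x, y} \<in> path_edges adj x z"
  then obtain p i where p: "is_path adj x z p" and i: "Suc i < length p"
    and e: "{x, y} = {p ! i, p ! Suc i}"
    unfolding path_edges_def by blast
  obtain q where q: "p = x # q" using p by (cases p) (auto simp: is_path_def)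
  have "distinct p" "p ! 0 = x" using p q by (auto simp: is_path_def)
  \<comment> \<open>A simple path starting at \<open>x\<close> never returns to \<open>x\<close>, so
    only its first edge can contain \<open>x\<close>.\<close>
  then have "p ! Suc i \<noteq> x" using i nth_eq_iff_index_eq[of p "Suc i" 0] by (cases p) auto
  then have "p ! i = x" "y = p ! Suc i" using e by (auto simp: doubleton_eq_iff)
  then have "i = 0" using i nth_eq_iff_index_eq[of p i 0] \<open>distinct p\<close> \<open>p ! 0 = x\<close>
    by (cases p) auto
  then have "q \<noteq> []" "hd q = y" using i q \<open>y = p ! Suc i\<close> by (auto simp: hd_conv_nth)
  then show "z \<in> branch adj x y"
    using p q by (auto simp: branch_def is_path_Cons)
next
  assume "z \<in> branch adj x y"
  then show "{x, y} \<in> path_edges adj x z"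
    using path_edges_extend[OF assms] by (auto simp: branch_def)
qed

lemma Lset_eq: "adj x y \<Longrightarrow> Lset V adj x y = leaves V adj \<inter> branch adj x y"
  by (auto simp: Lset_def edge_in_path_iff_branch)

lemma path_adj: "adj x y \<Longrightarrow> is_path adj x y [x, y]"
  using adjD by (auto simp: is_path_Cons)

text \<open>The initial segment ending at \<open>y\<close> is a path from \<open>x\<close> to its
  neighbour \<open>y\<close>, hence by uniqueness the single edge.\<close>

lemma neighbour_on_path:
  assumes "adj x y" and p: "is_path adj x z (x # q)" and "y \<in> set q"
  shows "hd q = y"
proof -
  have q: "x \<notin> set q" "adj x (hd q)" "is_path adj (hd q) z q"
    using assms by (auto simp: is_path_Cons split: if_splits)
  obtain r where r: "is_path adj (hd q) y r" "set r \<subseteq> set q"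
    using is_path_prefix[OF q(3) assms(3)] .
  then have "is_path adj x y (x # r)" using path_extend[OF q(2) r(1)] q(1) by blast
  then have "r = [y]" using path_unique path_adj[OF assms(1)] by blast
  then show ?thesis using r(1) by (simp add: is_path_def)
qed

lemma branch_disjoint:
  assumes "adj x y" shows "branch adj x y \<inter> branch adj y x = {}"
proof -
  have False if "is_path adj y z q" "x \<notin> set q" "is_path adj x z r" "y \<notin> set r" for z q r
    using path_unique[OF path_extend[OF assms that(1,2)] that(3)] that(1,4)
    by (auto simp: is_path_def)
  then show ?thesis by (auto simp: branch_def)
qed

lemma branch_cover:
  assumes "x \<in> V" and "z \<in> V" and "z \<noteq> x"
  obtains y where "adj x y" "z \<in> branch adj x y"
proof -
  obtain p where p: "is_path adj x z p" using path_exists assms by blast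
  then obtain q where "p = x # q" by (cases p) (auto simp: is_path_def)
  then have "adj x (hd q)" "z \<in> branch adj x (hd q)"
    using p assms by (auto simp: is_path_Cons branch_def split: if_splits)
  with that show ?thesis by blast
qed

text \<open>A path into the branch through \<open>p\<close>, prolonged backwards to
  \<open>x\<close>, still misses \<open>y\<close>, since a neighbour of \<open>x\<close> can only
  occur right after \<open>x\<close>. This makes the induction from the leaves inwards well
  founded.\<close>

lemma branch_mono:
  assumes xy: "adj x y" and xp: "adj x p" and "y \<noteq> p"
  shows "branch adj x p \<subseteq> branch adj y x"
proof
  fix z assume "z \<in> branch adj x p"
  then obtain q where q: "is_path adj p z q" "x \<notin> set q" by (auto simp: branch_def)
  then have "is_path adj x z (x # q)" using path_extend xp by blast
  moreover from this have "y \<notin> set (x # q)"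
    using neighbour_on_path[OF xy, of z q] q \<open>y \<noteq> p\<close> adjD[OF xy] by (auto simp: is_path_def)
  ultimately show "z \<in> branch adj y x" by (auto simp: branch_def)
qed

lemma branch_base: "x \<in> branch adj y x \<longleftrightarrow> x \<noteq> y"
proof
  assume "x \<in> branch adj y x"
  then show "x \<noteq> y" by (auto simp: branch_def is_path_def)
next
  assume "x \<noteq> y"
  then have "is_path adj x x [x]" "y \<notin> set [x]" by (auto simp: is_path_def)
  then show "x \<in> branch adj y x" unfolding branch_def by blast
qed

lemma not_in_own_branch: "x \<notin> branch adj x p"
  by (auto simp: branch_def is_path_def)

lemma branch_leaf:
  assumes xy: "adj x y" and y: "valency adj y = 1"
  shows "branch adj x y = {y}"
proof -
  have y1: "a = x" if "adj y a" for a
    using y that adjD[OF xy] unfolding valency_def nbrs_def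
    by (metis (mono_tags, lifting) card_1_singletonE mem_Collect_eq singletonD)
  have "z = y" if q: "is_path adj y z q" "x \<notin> set q" for z q
  proof -
    obtain q' where q': "q = y # q'" using q by (cases q) (auto simp: is_path_def)
    then show ?thesis using q y1[of "hd q'"] by (cases q') (auto simp: is_path_Cons)
  qed
  then show ?thesis using branch_base[of y x] adjD[OF xy] by (auto simp: branch_def)
qed

section \<open>Linking numbers across an edge\<close>

lemma path_refl: "is_path adj u u [u]"
  by (simp add: is_path_def)

text \<open>The trivial path has one vertex and no edge, so at a node the product formula reproduces
  the convention that the linking number of \<open>u\<close> with itself is d_u. Later arguments
  thus avoid a case split.\<close>

lemma ell_eq_prod:
  assumes "u \<in> nodes V adj"
  shows "ell V adj d u v = (\<Prod>w\<in>path_verts adj u v \<inter> nodes V adj.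
           \<Prod>x\<in>{x. adj w x \<and> {w, x} \<notin> path_edges adj u v}. d w x)"
proof (cases "u = v")
  case True
  have "path_verts adj u u = {u}" "path_edges adj u u = {}"
    using path_verts_eq[OF path_refl] path_edges_eq[OF path_refl] by auto
  then show ?thesis using True assms by (simp add: ell_def dv_def nbrs_def)
qed (simp add: ell_def)

text \<open>The two products agree away from \<open>x\<close> and \<open>y\<close>. Starting at
  \<open>x\<close> instead of \<open>y\<close> adds the factor d_x / \<open>d x y\<close> at
  \<open>x\<close> and loses the factor \<open>d y x\<close> at \<open>y\<close>; clearing
  denominators gives the identity.\<close>

lemma ell_across_edge:
  assumes x: "x \<in> nodes V adj" and y: "y \<in> nodes V adj" and xy: "adj x y"
    and mu: "mu \<in> branch adj x y"
  shows "ell V adj d x mu * (d x y * d y x) = dv adj d x * ell V adj d y mu"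
proof -
  obtain q where q: "is_path adj y mu q" "x \<notin> set q" using mu by (auto simp: branch_def)
  define E where "E = path_edges adj y mu"
  define h where "h A w = (\<Prod>z\<in>{z. adj w z \<and> {w, z} \<notin> A}. d w z)" for A w
  define R where "R = set q \<inter> nodes V adj - {y}"
  have E': "path_edges adj x mu = insert {x, y} E"
    unfolding E_def by (rule path_edges_extend[OF xy q])
  have yq: "y \<in> set q" using q by (auto simp: is_path_def)
  have E_q: "e \<subseteq> set q" if "e \<in> E" for e
    using path_edge_subset[OF q(1)] that by (simp add: E_def)
  have fin: "finite {z. adj w z \<and> P z}" for w P
    by (rule finite_subset[OF _ finite_nbrs[of w]]) (auto simp: nbrs_def)
  have "finite R" "x \<notin> insert y R" "y \<notin> R"
    using q adjD[OF xy] by (auto simp: R_def)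
  moreover have "path_verts adj x mu \<inter> nodes V adj = insert x (insert y R)"
    using path_verts_eq[OF path_extend[OF xy q]] x y yq by (auto simp: R_def)
  moreover have "path_verts adj y mu \<inter> nodes V adj = insert y R"
    using path_verts_eq[OF q(1)] y yq by (auto simp: R_def)
  moreover have "prod (h (insert {x, y} E)) R = prod (h E) R"
    using q(2) by (intro prod.cong refl) (auto simp: h_def R_def doubleton_eq_iff intro!: prod.cong)
  ultimately have
    x_mu: "ell V adj d x mu = h (insert {x, y} E) x * (h (insert {x, y} E) y * prod (h E) R)" and
    y_mu: "ell V adj d y mu = h E y * prod (h E) R"
    unfolding ell_eq_prod[OF x] ell_eq_prod[OF y] E' E_def[symmetric] h_def[symmetric] by auto
  \<comment> \<open>The path from \<open>y\<close> avoids \<open>x\<close>, so \<open>d y x\<close>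
    occurs in the product from \<open>y\<close>; it disappears once the edge \<open>{x, y}\<close>
    belongs to the path.\<close>
  have "{z. adj y z \<and> {y, z} \<notin> E} = insert x {z. adj y z \<and> {y, z} \<notin> insert {x, y} E}"
    using E_q[of "{y, x}"] q(2) adjD[OF xy] by (auto simp: doubleton_eq_iff)
  then have hy: "h E y = d y x * h (insert {x, y} E) y"
    unfolding h_def using fin by (simp add: insert_commute)
  have "nbrs adj x = insert y {z. adj x z \<and> {x, z} \<notin> insert {x, y} E}"
    using E_q q(2) xy adjD[OF xy] by (auto simp: nbrs_def doubleton_eq_iff)
  then have "dv adj d x = d x y * h (insert {x, y} E) x"
    unfolding dv_def h_def using fin by simp
  then show ?thesis by (simp add: x_mu y_mu hy)
qed

lemma ell_pos:
  assumes "weights_ok V adj d" and "u \<in> nodes V adj"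
  shows "ell V adj d u v > 0"
  unfolding ell_eq_prod[OF assms(2)] using assms(1)
  by (auto simp: weights_ok_def nbrs_def intro!: prod_pos)

lemma dv_pos:
  assumes "weights_ok V adj d" and "u \<in> nodes V adj"
  shows "dv adj d u > 0"
  using assms by (auto simp: dv_def weights_ok_def intro!: prod_pos)

text \<open>Crossing the edge with \<open>y\<close> itself as target gives d_x d_y = \<ell>(x,y) N
  for N = \<open>d x y * d y x\<close>, and the edge determinant condition says \<ell>(x,y) <
  N.\<close>

lemma edge_determinant_dv:
  assumes "weights_ok V adj d" and "edge_determinant V adj d"
    and x: "x \<in> nodes V adj" and y: "y \<in> nodes V adj" and xy: "adj x y"
  shows "dv adj d x * dv adj d y < (d x y * d y x) * (d x y * d y x)"
proof -
  have "y \<in> branch adj x y" using branch_base[of y x] adjD[OF xy] by blast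
  then have "dv adj d x * dv adj d y = ell V adj d x y * (d x y * d y x)"
    using ell_across_edge[OF x y xy] by (simp add: ell_def)
  moreover have "ell V adj d x y < d x y * d y x"
    using assms by (auto simp: edge_determinant_def)
  ultimately show ?thesis by (simp only: mult_less_mono1 order.strict_trans1[OF le0])
qed

end

section \<open>Leaves minimising the ratio of two weight vectors\<close>

text \<open>When the linking numbers from \<open>u\<close> are positive and \<open>S\<close> is
  finite and nonempty, the minimal ratio is the largest t with w \<ge> t w_u on \<open>S\<close>,
  and this set is the locus of equality.\<close>

definition min_leaves ::
  "'v set \<Rightarrow> ('v \<Rightarrow> 'v \<Rightarrow> bool) \<Rightarrow> ('v \<Rightarrow> 'v \<Rightarrow> nat) \<Rightarrow> 'v set \<Rightarrow> ('v \<Rightarrow> real) \<Rightarrow> 'v \<Rightarrow> 'v set" where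
  "min_leaves V adj d S w u = {mu \<in> S. \<forall>nu\<in>S.
     w mu / real (ell V adj d u mu) \<le> w nu / real (ell V adj d u nu)}"

lemma min_leaves_nonempty:
  assumes "finite S" and "S \<noteq> {}"
  shows "min_leaves V adj d S w u \<noteq> {}"
  using ex_min_if_finite[of "(\<lambda>mu. w mu / real (ell V adj d u mu)) ` S"] assms
  by (fastforce simp: min_leaves_def not_less)

section \<open>Propagation of minimising leaves along edges\<close>

context finite_tree
begin

text \<open>Passing from \<open>x\<close> to \<open>y\<close> multiplies the ratios on the branch
  beyond \<open>y\<close> by X/N; passing from \<open>y\<close> to \<open>x\<close> multiplies those
  beyond \<open>x\<close> by Y/N. A minimiser \<open>nu\<close> for \<open>y\<close> beyond
  \<open>x\<close> would satisfy r_y(nu) \<le> r_y(mu) = r_x(mu) X/N \<le> r_x(nu) X/N = r_y(nu)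
  XY/N^2, impossible as XY < N^2. Within the branch beyond \<open>y\<close> the common factor
  preserves comparisons, which gives the second claim.\<close>

lemma min_leaves_across_edge:
  assumes wt: "weights_ok V adj d" and ed: "edge_determinant V adj d"
    and x: "x \<in> nodes V adj" and y: "y \<in> nodes V adj" and xy: "adj x y"
    and w: "\<And>mu. mu \<in> S \<Longrightarrow> w mu > 0"
    and mu: "mu \<in> min_leaves V adj d S w x" "mu \<in> branch adj x y"
  shows "min_leaves V adj d S w y \<inter> branch adj y x = {}"
    and "min_leaves V adj d S w y \<inter> branch adj x y \<subseteq> min_leaves V adj d S w x"
proof -
  define N where "N = real (d x y * d y x)"
  define r where "r u nu = w nu / real (ell V adj d u nu)" for u nu
  define X Y where "X = real (dv adj d x)" and "Y = real (dv adj d y)"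
  have XY: "X > 0" "Y > 0" "X * Y < N * N"
    using dv_pos[OF wt] x y edge_determinant_dv[OF wt ed x y xy]
    by (simp_all add: X_def Y_def N_def flip: of_nat_mult)
  have yx: "adj y x" using xy adj_commute by blast
  have N: "N > 0" using wt x y xy yx by (auto simp: N_def weights_ok_def nbrs_def)
  have rxy: "r y nu = r x nu * (X / N)" if "nu \<in> branch adj x y" for nu
  proof -
    have "real (ell V adj d x nu) * N = X * real (ell V adj d y nu)"
      using ell_across_edge[OF x y xy that, of d] unfolding N_def X_def by (metis of_nat_mult)
    then have "real (ell V adj d x nu) = X * real (ell V adj d y nu) / N"
      using N by (simp add: field_simps)
    then show ?thesis using N XY by (simp add: r_def)
  qed
  have ryx: "r x nu = r y nu * (Y / N)" if "nu \<in> branch adj y x" for nu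
  proof -
    have "real (ell V adj d y nu) * N = Y * real (ell V adj d x nu)"
      using ell_across_edge[OF y x yx that, of d] unfolding N_def Y_def
      by (metis of_nat_mult mult.commute)
    then have "real (ell V adj d y nu) = Y * real (ell V adj d x nu) / N"
      using N by (simp add: field_simps)
    then show ?thesis using N XY by (simp add: r_def)
  qed
  have r_pos: "r y nu > 0" if "nu \<in> S" for nu
    using w[OF that] ell_pos[OF wt y] by (simp add: r_def)
  have S: "mu \<in> S" and min_x: "\<And>nu. nu \<in> S \<Longrightarrow> r x mu \<le> r x nu"
    using mu(1) by (auto simp: min_leaves_def r_def)
  show "min_leaves V adj d S w y \<inter> branch adj y x = {}"
  proof (rule ccontr)
    assume "min_leaves V adj d S w y \<inter> branch adj y x \<noteq> {}"
    then obtain nu where nu: "nu \<in> S" "nu \<in> branch adj y x" and "r y nu \<le> r y mu"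
      using S by (auto simp: min_leaves_def r_def)
    then have "r y nu \<le> r x mu * (X / N)" using rxy[OF mu(2)] by simp
    also have "\<dots> \<le> r x nu * (X / N)"
      using min_x[OF nu(1)] XY N by (intro mult_right_mono) auto
    also have "\<dots> = r y nu * (X * Y / (N * N))" using ryx[OF nu(2)] by simp
    also have "\<dots> < r y nu * 1"
      using r_pos[OF nu(1)] XY N by (intro mult_strict_left_mono) auto
    finally show False by simp
  qed
  show "min_leaves V adj d S w y \<inter> branch adj x y \<subseteq> min_leaves V adj d S w x"
  proof
    fix nu assume "nu \<in> min_leaves V adj d S w y \<inter> branch adj x y"
    then have nu: "nu \<in> S" "nu \<in> branch adj x y" and "r y nu \<le> r y mu"
      using S by (auto simp: min_leaves_def r_def)
    then have "r x nu * (X / N) \<le> r x mu * (X / N)" using rxy mu(2) by simp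
    then have "r x nu \<le> r x mu"
      using XY N by (meson divide_pos_pos mult_le_cancel_right_pos)
    then show "nu \<in> min_leaves V adj d S w x"
      using nu(1) min_x by (force simp: min_leaves_def r_def intro: order_trans)
  qed
qed

text \<open>\<open>A x y\<close> abstracts the support of the admissible monomial. One minimiser
  beyond \<open>y\<close> makes the minimisers for \<open>y\<close> miss the branch back to
  \<open>x\<close>, so induction at \<open>y\<close> fills everything beyond \<open>y\<close>. Some
  branch \<open>e\<close> other than \<open>p\<close> contains a minimiser and is therefore full;
  \<open>balanced\<close> then puts minimisers into all branches except \<open>p\<close>, and these
  fill up in turn.\<close>

lemma min_leaves_fill:
  fixes A :: "'v \<Rightarrow> 'v \<Rightarrow> 'v set"
  assumes wt: "weights_ok V adj d" and ed: "edge_determinant V adj d"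
    and w: "\<And>mu. mu \<in> S \<Longrightarrow> w mu > 0" and S: "S \<subseteq> leaves V adj" "S \<noteq> {}"
    and A: "\<And>x y. x \<in> nodes V adj \<Longrightarrow> adj x y \<Longrightarrow> A x y \<noteq> {} \<and> A x y \<subseteq> Lset V adj x y"
    and balanced: "\<And>x e p y. x \<in> nodes V adj \<Longrightarrow> adj x e \<Longrightarrow> adj x p \<Longrightarrow> adj x y \<Longrightarrow> y \<noteq> p \<Longrightarrow>
      A x e \<subseteq> min_leaves V adj d S w x \<Longrightarrow> \<not> A x p \<subseteq> min_leaves V adj d S w x \<Longrightarrow>
      A x y \<subseteq> min_leaves V adj d S w x"
    and "x \<in> nodes V adj" and "adj x p" and "min_leaves V adj d S w x \<inter> branch adj x p = {}"
  shows "leaves V adj - branch adj x p \<subseteq> min_leaves V adj d S w x"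
  using assms(8-10)
proof (induction "card (V - branch adj x p)" arbitrary: x p rule: less_induct)
  case less
  let ?Z = "min_leaves V adj d S w"
  have leaf_node: "mu \<noteq> x" "mu \<in> V" if "mu \<in> leaves V adj" for mu
    using that less.prems by (auto simp: leaves_def nodes_def)
  have A_branch: "A x y \<noteq> {}" "A x y \<subseteq> leaves V adj \<inter> branch adj x y" if "adj x y" for y
    using A[OF less.prems(1) that] Lset_eq[OF that] by auto
  have fill: "leaves V adj \<inter> branch adj x y \<subseteq> ?Z x"
    if y: "adj x y" "y \<noteq> p" and mu: "mu \<in> ?Z x" "mu \<in> branch adj x y" for y mu
  proof (cases "valency adj y = 1")
    case True
    then show ?thesis using branch_leaf[OF y(1)] mu by auto
  next
    case False
    then have yn: "y \<in> nodes V adj" using adjD[OF y(1)] by (auto simp: nodes_def)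
    have yx: "adj y x" using y adj_commute by blast
    note step = min_leaves_across_edge[OF wt ed less.prems(1) yn y(1) w mu]
    \<comment> \<open>The complement loses at least \<open>x\<close>, which lies in
      \<open>branch adj y x\<close> but not in \<open>branch adj x p\<close>.\<close>
    have "V - branch adj y x \<subset> V - branch adj x p"
      using branch_mono[OF y(1) less.prems(2) y(2)] branch_base[of x y] adjD[OF y(1)]
        not_in_own_branch[of x p] by blast
    then have "card (V - branch adj y x) < card (V - branch adj x p)"
      using finite_V by (intro psubset_card_mono) auto
    then have "leaves V adj - branch adj y x \<subseteq> ?Z y"
      using less.hyps yn yx step(1) by blast
    then show ?thesis using step(2) branch_disjoint[OF y(1)] by blast
  qed
  have "finite S"
    by (rule finite_subset[OF _ finite_V]) (use S in \<open>auto simp: leaves_def\<close>)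
  then obtain mu where mu: "mu \<in> ?Z x" using min_leaves_nonempty[OF _ S(2)] by blast
  then have "mu \<in> leaves V adj" using S by (auto simp: min_leaves_def)
  then obtain e where e: "adj x e" "mu \<in> branch adj x e"
    using branch_cover leaf_node adjD[OF less.prems(2)] by metis
  then have "e \<noteq> p" using mu less.prems(3) by blast
  then have "A x e \<subseteq> ?Z x" using fill[OF e(1) _ mu e(2)] A_branch[OF e(1)] by blast
  moreover have "\<not> A x p \<subseteq> ?Z x" using A_branch[OF less.prems(2)] less.prems(3) by blast
  ultimately have all: "A x y \<subseteq> ?Z x" if "adj x y" "y \<noteq> p" for y
    using balanced[OF less.prems(1) e(1) less.prems(2)] that by blast
  show ?case
  proof
    fix nu assume nu: "nu \<in> leaves V adj - branch adj x p"
    then obtain y where y: "adj x y" "nu \<in> branch adj x y"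
      using branch_cover[of x nu] leaf_node[of nu] adjD[OF less.prems(2)] by auto
    then have "y \<noteq> p" using nu by blast
    \<comment> \<open>Any leaf of the nonempty support serves as the one minimiser that
      \<open>fill\<close> asks for.\<close>
    obtain kap where "kap \<in> A x y" using A_branch[OF y(1)] by blast
    then have "kap \<in> ?Z x" "kap \<in> branch adj x y"
      using all[OF y(1) \<open>y \<noteq> p\<close>] A_branch[OF y(1)] by auto
    then show "nu \<in> ?Z x" using fill[OF y(1) \<open>y \<noteq> p\<close>] y nu by blast
  qed
qed

end

section \<open>Monomial initial forms\<close>

text \<open>Scalars as ring elements, so that complex linear combinations of generators lie in the
  ideal.\<close>

definition const_ser :: "complex \<Rightarrow> 'v pser" where
  "const_ser c = (\<lambda>m. if m = (\<lambda>_. 0) then c else 0)"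

lemma const_ser_conv_ring: "const_ser c \<in> conv_ring S"
  unfolding conv_ring_def
  by (intro CollectI conjI exI[of _ "norm c"] exI[of _ 1]) (auto simp: const_ser_def expos_def)

text \<open>The type \<open>'v\<close> may be infinite, and \<open>sum\<close> over an infinite set
  is 0 by convention. Support in the finite set \<open>S\<close> makes the convolution in
  \<open>ps_mult\<close> a genuine finite sum.\<close>

lemma finite_le_exponents:
  assumes "finite S" and "m \<in> expos S"
  shows "finite {a. \<forall>x. a x \<le> m x}"
proof (rule finite_subset)
  show "finite {a. \<forall>x. (x \<in> S \<longrightarrow> a x \<in> {..sum m S}) \<and> (x \<notin> S \<longrightarrow> a x = 0)}"
    by (rule finite_set_of_finite_funs) (use assms in auto)
  show "{a. \<forall>x. a x \<le> m x} \<subseteq> {a. \<forall>x. (x \<in> S \<longrightarrow> a x \<in> {..sum m S}) \<and> (x \<notin> S \<longrightarrow> a x = 0)}"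
  proof (clarify, intro conjI impI)
    fix a x assume a: "\<forall>x. a x \<le> m x"
    show "a x \<in> {..sum m S}" if "x \<in> S"
      using a[rule_format, of x] member_le_sum[OF that, of m] assms(1) by simp
    show "a x = 0" if "x \<notin> S"
      using a[rule_format, of x] assms(2) that by (simp add: expos_def)
  qed
qed

lemma ps_mult_const_ser:
  fixes S :: "'v set" and g :: "'v pser"
  assumes "finite S" and g: "\<And>m. g m \<noteq> 0 \<Longrightarrow> m \<in> expos S"
  shows "ps_mult (const_ser c) g = (\<lambda>m. c * g m)"
proof
  fix m :: "'v \<Rightarrow> nat"
  let ?A = "{a. \<forall>x. a x \<le> m x}"
  have eq: "const_ser c a * g (\<lambda>x. m x - a x) = (if a = (\<lambda>_. 0) then c * g m else 0)" for a
    by (simp add: const_ser_def)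
  show "ps_mult (const_ser c) g m = c * g m"
  proof (cases "m \<in> expos S")
    case True
    then have "finite ?A" by (rule finite_le_exponents[OF assms(1)])
    then show ?thesis unfolding ps_mult_def eq by simp
  next
    case False
    \<comment> \<open>The index set may be infinite here, but every term vanishes.\<close>
    then have "g m = 0" using g by blast
    then show ?thesis unfolding ps_mult_def eq by (auto intro!: sum.neutral)
  qed
qed

lemma ideal_gen_superset:
  fixes S :: "'v set" and f :: "'v pser"
  assumes "finite S" and "f \<in> G" and "\<And>m. f m \<noteq> 0 \<Longrightarrow> m \<in> expos S"
  shows "f \<in> ideal_gen (conv_ring S) G"
proof -
  have "ps_mult (const_ser 1) f = f"
    using ps_mult_const_ser[of S f 1] assms(1,3) by simp
  then show ?thesis
    unfolding ideal_gen_def using assms(2) const_ser_conv_ring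
    by (intro CollectI, intro exI[of _ "1::nat"] exI[of _ "\<lambda>_. const_ser 1"] exI[of _ "\<lambda>_. f"]) auto
qed

lemma initial_eq_monom:
  assumes "f a = 1" and "\<And>m. f m \<noteq> 0 \<Longrightarrow> m \<noteq> a \<Longrightarrow> wdot S w a < wdot S w m"
  shows "initial S w f = monom a"
proof
  fix m
  show "initial S w f m = monom a m"
  proof (cases "m = a")
    case True
    then show ?thesis using assms by (fastforce simp: initial_def monom_def)
  next
    case False
    then show ?thesis using assms(1) assms(2)[of m]
      by (auto simp: initial_def monom_def not_le intro!: exI[of _ a])
  qed
qed

text \<open>The solution is column \<open>k\<close> of the inverse matrix.\<close>

lemma solve_unit_vector:
  fixes A :: "'a::field mat"
  assumes "A \<in> carrier_mat n n" and "det A \<noteq> 0" and "k < n"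
  obtains y where "\<And>i. i < n \<Longrightarrow> (\<Sum>j<n. A $$ (i, j) * y j) = (if i = k then 1 else 0)"
proof -
  have "A \<in> Units (ring_mat TYPE('a) n ())" by (rule det_non_zero_imp_unit[OF assms(1,2)])
  then obtain B where B: "B \<in> carrier_mat n n" "A * B = 1\<^sub>m n"
    by (auto simp: Units_def ring_mat_def)
  have "(\<Sum>j<n. A $$ (i, j) * B $$ (j, k)) = (if i = k then 1 else 0)" if "i < n" for i
  proof -
    have "(A * B) $$ (i, k) = (\<Sum>j<n. A $$ (i, j) * B $$ (j, k))"
      using that assms(1,3) B(1) by (simp add: scalar_prod_def lessThan_atLeast0)
    then show ?thesis using B that assms(3) by simp
  qed
  with that[of "\<lambda>j. B $$ (j, k)"] show ?thesis by blast
qed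

section \<open>Monomials in the initial ideal of a truncated system\<close>

context finite_tree
begin

lemma finite_leaves: "finite (leaves V adj)"
  by (rule finite_subset[OF _ finite_V]) (auto simp: leaves_def)

lemma node_weight_alpha:
  assumes "splice_type_system V adj d alpha c g F" and "u \<in> nodes V adj" and "x \<in> nbrs adj u"
  shows "node_weight V adj d u (alpha u x) = dv adj d u"
proof -
  have "node_weight V adj d u (alpha u x) =
      (\<Sum>mu\<in>Lset V adj u x. ell V adj d u mu * alpha u x mu)"
    unfolding node_weight_def
    using assms by (intro sum.mono_neutral_right finite_leaves)
      (auto simp: Lset_def splice_type_system_def)
  then show ?thesis using assms by (simp add: splice_type_system_def mult.commute)
qed

text \<open>The difference of the two weights is a sum of nonnegative terms (w_\<mu> - t
  \<ell>(u,\<mu>)) m_\<mu>. It is positive as soon as one leaf in the support of \<open>m\<close>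
  has excess, and zero if none has.\<close>

lemma wdot_ge_node_weight:
  assumes "\<And>mu. mu \<in> leaves V adj - T \<Longrightarrow> t * real (ell V adj d u mu) \<le> w mu"
    and "m \<in> expos (leaves V adj - T)"
  shows "t * real (node_weight V adj d u m) \<le> wdot (leaves V adj - T) w m"
    and "nu \<in> leaves V adj - T \<Longrightarrow> t * real (ell V adj d u nu) < w nu \<Longrightarrow> m nu \<noteq> 0 \<Longrightarrow>
      t * real (node_weight V adj d u m) < wdot (leaves V adj - T) w m"
    and "(\<And>mu. m mu \<noteq> 0 \<Longrightarrow> w mu = t * real (ell V adj d u mu)) \<Longrightarrow>
      wdot (leaves V adj - T) w m = t * real (node_weight V adj d u m)"
proof -
  have "node_weight V adj d u m = (\<Sum>mu\<in>leaves V adj - T. ell V adj d u mu * m mu)"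
    unfolding node_weight_def
    using assms(2) by (intro sum.mono_neutral_right finite_leaves) (auto simp: expos_def)
  then have nw: "t * real (node_weight V adj d u m) =
      (\<Sum>mu\<in>leaves V adj - T. t * real (ell V adj d u mu) * real (m mu))"
    by (simp add: sum_distrib_left mult.assoc)
  have le: "t * real (ell V adj d u mu) * real (m mu) \<le> w mu * real (m mu)"
    if "mu \<in> leaves V adj - T" for mu
    using assms(1)[OF that] by (intro mult_right_mono) auto
  show "t * real (node_weight V adj d u m) \<le> wdot (leaves V adj - T) w m"
    unfolding nw wdot_def by (rule sum_mono[OF le])
  show "t * real (node_weight V adj d u m) < wdot (leaves V adj - T) w m"
    if "nu \<in> leaves V adj - T" "t * real (ell V adj d u nu) < w nu" "m nu \<noteq> 0"
    unfolding nw wdot_def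
  proof (rule sum_strict_mono_ex1)
    show "\<exists>mu\<in>leaves V adj - T. t * real (ell V adj d u mu) * real (m mu) < w mu * real (m mu)"
      using that by (intro bexI[of _ nu] mult_strict_right_mono) auto
  qed (use le finite_leaves in auto)
  show "wdot (leaves V adj - T) w m = t * real (node_weight V adj d u m)"
    if "\<And>mu. m mu \<noteq> 0 \<Longrightarrow> w mu = t * real (ell V adj d u mu)"
    unfolding nw wdot_def using that by (intro sum.cong refl) fastforce
qed

text \<open>Solving for the edges other than \<open>p\<close> and \<open>q\<close> isolates the monomial of \<open>e\<close>. The lower bound
  \<open>w \<ge> t w\<^sub>u\<close> makes \<open>w\<close> at least \<open>t d\<^sub>u\<close> on every term, with equality on that of \<open>e\<close> only.\<close>

lemma monom_in_initial_ideal: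
  fixes T w
  defines "S \<equiv> leaves V adj - T"
  assumes sys: "splice_type_system V adj d alpha c g F" and u: "u \<in> nodes V adj"
    and e: "e \<in> nbrs adj u" and p: "p \<in> nbrs adj u" and q: "q \<in> nbrs adj u" and "p \<noteq> q"
    and "t > 0" and w: "\<And>mu. mu \<in> S \<Longrightarrow> t * real (ell V adj d u mu) \<le> w mu"
    and min_e: "{mu. alpha u e mu \<noteq> 0} \<subseteq> {mu \<in> S. w mu = t * real (ell V adj d u mu)}"
    and min_p: "\<not> {mu. alpha u p mu \<noteq> 0} \<subseteq> {mu \<in> S. w mu = t * real (ell V adj d u mu)}"
    and min_q: "\<not> {mu. alpha u q mu \<noteq> 0} \<subseteq> {mu \<in> S. w mu = t * real (ell V adj d u mu)}"
  shows "alpha u e \<in> expos S"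
    and "monom (alpha u e) \<in> ideal_gen (conv_ring S) (initial S w ` J_tau V adj F T)"
proof -
  define n where "n = valency adj u - 2"
  define N where "N = nbrs adj u - {p, q}"
  have finS: "finite S" using finite_leaves by (simp add: S_def)
  \<comment> \<open>The support of \<open>e\<close> satisfies an inclusion that fails for
    \<open>p\<close> and \<open>q\<close>, so \<open>e\<close> is neither of them.\<close>
  have "e \<in> N" using e min_e min_p min_q by (auto simp: N_def)
  have "card N = n"
    using card_Diff_subset[of "{p, q}" "nbrs adj u"] p q \<open>p \<noteq> q\<close>
    by (simp add: N_def n_def valency_def)
  then obtain b where b: "bij_betw b {0..<n} N"
    using ex_bij_betw_nat_finite[of N] finite_nbrs by (auto simp: N_def)
  then obtain k where k: "k < n" "b k = e"
    using \<open>e \<in> N\<close> by (auto simp: bij_betw_def)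
  let ?A = "mat n n (\<lambda>(i, j). c u (b i) (Suc j))"
  have "N \<subseteq> nbrs adj u" by (auto simp: N_def)
  \<comment> \<open>Removing two edges leaves as many edges as equations, so this is a maximal minor
    of the coefficient matrix. The shift \<open>Suc j\<close> matches equations numbered from
    1.\<close>
  then have "det ?A \<noteq> 0"
    using sys u b \<open>card N = n\<close> unfolding splice_type_system_def n_def by blast
  then obtain y where y: "\<And>i. i < n \<Longrightarrow> (\<Sum>j<n. ?A $$ (i, j) * y j) = (if i = k then 1 else 0)"
    using solve_unit_vector[of ?A n k] k by auto
  have coef: "(\<Sum>j<n. y j * c u x (Suc j)) = (if x = e then 1 else 0)" if xN: "x \<in> N" for x
  proof -
    obtain i where i: "i < n" "x = b i" using xN b by (auto simp: bij_betw_def)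
    then have "x = e \<longleftrightarrow> i = k" using b k by (auto simp: bij_betw_def inj_on_def)
    then show ?thesis using y[OF i(1)] i by (simp add: mult.commute)
  qed
  have "\<forall>i\<in>{1..n}. g u i \<in> conv_ring (leaves V adj) \<and>
      (\<forall>m. g u i m \<noteq> 0 \<longrightarrow> node_weight V adj d u m > dv adj d u) \<and>
      F u i = (\<lambda>m. (\<Sum>x\<in>nbrs adj u. c u x i * monom (alpha u x) m) + g u i m)"
    using sys u unfolding splice_type_system_def n_def by blast
  then have g: "g u (Suc j) \<in> conv_ring (leaves V adj)"
    "\<And>m. g u (Suc j) m \<noteq> 0 \<Longrightarrow> node_weight V adj d u m > dv adj d u"
    "F u (Suc j) = (\<lambda>m. (\<Sum>x\<in>nbrs adj u. c u x (Suc j) * monom (alpha u x) m) + g u (Suc j) m)"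
    if "j < n" for j
    using that by auto
  have alpha: "alpha u x \<in> expos (leaves V adj)" if "x \<in> nbrs adj u" for x
    using sys u that by (auto simp: splice_type_system_def expos_def Lset_def)
  have supp_F: "m \<in> expos (leaves V adj)" if "F u (Suc j) m \<noteq> 0" "j < n" for j m
  proof (rule ccontr)
    assume m: "m \<notin> expos (leaves V adj)"
    then have "monom (alpha u x) m = 0" if "x \<in> nbrs adj u" for x
      using alpha[OF that] by (auto simp: monom_def)
    moreover have "g u (Suc j) m = 0" using g(1)[OF that(2)] m by (auto simp: conv_ring_def)
    ultimately show False using that g(3)[OF that(2)] by simp
  qed
  have supp_trunc: "m \<in> expos S" if "trunc T (F u (Suc j)) m \<noteq> 0" "j < n" for j m
    using that supp_F[of j m] by (auto simp: trunc_def S_def expos_def split: if_splits)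
  define f where
    "f = (\<lambda>m. \<Sum>j<n. ps_mult (const_ser (y j)) (trunc T (F u (Suc j))) m)"
  have "f \<in> J_tau V adj F T"
    unfolding J_tau_def ideal_gen_def f_def
  proof (intro CollectI exI conjI)
    show "\<forall>j<n. const_ser (y j) \<in> conv_ring (leaves V adj - T) \<and> trunc T (F u (Suc j))
        \<in> {trunc T (F v i) | v i. v \<in> nodes V adj \<and> i \<in> {1..valency adj v - 2}}"
      using u const_ser_conv_ring by (force simp: n_def)
  qed (rule refl)
  have f_eq: "f m = (\<Sum>j<n. y j * trunc T (F u (Suc j)) m)" for m
    unfolding f_def
  proof (intro sum.cong refl)
    fix j assume "j \<in> {..<n}"
    then have "ps_mult (const_ser (y j)) (trunc T (F u (Suc j))) =
        (\<lambda>m. y j * trunc T (F u (Suc j)) m)"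
      using supp_trunc by (intro ps_mult_const_ser[OF finS]) auto
    then show "ps_mult (const_ser (y j)) (trunc T (F u (Suc j))) m = y j * trunc T (F u (Suc j)) m"
      by simp
  qed
  \<comment> \<open>Truncation changes nothing at exponents that avoid \<open>T\<close>.\<close>
  have f_S: "f m = (\<Sum>x\<in>nbrs adj u. (\<Sum>j<n. y j * c u x (Suc j)) * monom (alpha u x) m)
      + (\<Sum>j<n. y j * g u (Suc j) m)" if "m \<in> expos S" for m
  proof -
    have "trunc T (F u (Suc j)) m =
        (\<Sum>x\<in>nbrs adj u. c u x (Suc j) * monom (alpha u x) m) + g u (Suc j) m" if "j < n" for j
      using \<open>m \<in> expos S\<close> fun_cong[OF g(3)[OF that], of m]
      by (auto simp: trunc_def S_def expos_def)
    then have "f m = (\<Sum>j<n. (\<Sum>x\<in>nbrs adj u. y j * c u x (Suc j) * monom (alpha u x) m)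
        + y j * g u (Suc j) m)"
      unfolding f_eq
      by (intro sum.cong refl) (simp add: distrib_left sum_distrib_left mult.assoc)
    also have "\<dots> = (\<Sum>x\<in>nbrs adj u. \<Sum>j<n. y j * c u x (Suc j) * monom (alpha u x) m)
        + (\<Sum>j<n. y j * g u (Suc j) m)"
      unfolding sum.distrib by (subst sum.swap) simp
    finally show ?thesis by (simp add: sum_distrib_right)
  qed
  have f_supp: "m \<in> expos S" if "f m \<noteq> 0" for m
    using that supp_trunc unfolding f_eq
    by (metis (mono_tags, lifting) lessThan_iff mult_zero_right sum.neutral)
  note wdot = wdot_ge_node_weight[of T t d u w, folded S_def, OF w]
  note dvu = node_weight_alpha[OF sys u]
  show e_S: "alpha u e \<in> expos S" using min_e by (auto simp: expos_def)
  have we: "wdot S w (alpha u e) = t * real (dv adj d u)"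
    using wdot(3)[OF _ e_S] min_e dvu[OF e] by auto
  \<comment> \<open>If the monomial of \<open>p\<close> or \<open>q\<close> survives truncation, its
    support lies in \<open>S\<close> and contains a leaf where w exceeds t w_u.\<close>
  have wpq: "t * real (dv adj d u) < wdot S w (alpha u x)"
    if "alpha u x \<in> expos S" "x = p \<or> x = q" for x
  proof -
    have "\<not> {mu. alpha u x mu \<noteq> 0} \<subseteq> {mu \<in> S. w mu = t * real (ell V adj d u mu)}"
      using that min_p min_q by auto
    then obtain nu where nu: "alpha u x nu \<noteq> 0" "nu \<notin> S \<or> w nu \<noteq> t * real (ell V adj d u nu)"
      by auto
    moreover from this have "nu \<in> S" using that by (auto simp: expos_def)
    ultimately have "t * real (ell V adj d u nu) < w nu" using w[of nu] by auto
    then show ?thesis using wdot(2)[OF _ that(1) \<open>nu \<in> S\<close>] nu dvu[of x] p q that by auto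
  qed
  have wg: "t * real (dv adj d u) < wdot S w m"
    if "m \<in> expos S" "g u (Suc j) m \<noteq> 0" "j < n" for m j
  proof -
    have "t * real (dv adj d u) < t * real (node_weight V adj d u m)"
      using g(2)[OF that(3,2)] \<open>t > 0\<close> by simp
    also have "\<dots> \<le> wdot S w m" using wdot(1)[OF _ that(1)] by simp
    finally show ?thesis .
  qed
  \<comment> \<open>Up to weight t d_u, the series \<open>g\<close> contributes nothing, the
    monomials of \<open>p\<close> and \<open>q\<close> are truncated or too heavy, and the other
    edges except \<open>e\<close> have coefficient 0.\<close>
  have f_low: "f m = monom (alpha u e) m" if m: "m \<in> expos S" "wdot S w m \<le> t * real (dv adj d u)" for m
  proof -
    have "g u (Suc j) m = 0" if "j < n" for j using wg[OF m(1) _ that] m(2) by force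
    moreover have "(\<Sum>j<n. y j * c u x (Suc j)) * monom (alpha u x) m =
        (if x = e then monom (alpha u e) m else 0)" if "x \<in> nbrs adj u" for x
    proof (cases "x \<in> N")
      case True
      then show ?thesis by (simp add: coef)
    next
      case False
      then have pq: "x = p \<or> x = q" using that by (simp add: N_def)
      show ?thesis
        using wpq[OF _ pq] m \<open>e \<in> N\<close> False by (auto simp: monom_def)
    qed
    ultimately have "f m = (\<Sum>x\<in>nbrs adj u. if x = e then monom (alpha u e) m else 0)"
      unfolding f_S[OF m(1)] by simp
    then show ?thesis using e finite_nbrs by simp
  qed
  have "initial S w f = monom (alpha u e)"
  proof (rule initial_eq_monom)
    show "f (alpha u e) = 1" using f_low[OF e_S] we by (simp add: monom_def)
    show "wdot S w (alpha u e) < wdot S w m" if "f m \<noteq> 0" "m \<noteq> alpha u e" for m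
      using f_low[OF f_supp[OF that(1)]] that we by (force simp: monom_def)
  qed
  then have "monom (alpha u e) \<in> initial S w ` J_tau V adj F T"
    using \<open>f \<in> J_tau V adj F T\<close> by (metis imageI)
  then show "monom (alpha u e) \<in> ideal_gen (conv_ring S) (initial S w ` J_tau V adj F T)"
    by (rule ideal_gen_superset[OF finS]) (use e_S in \<open>auto simp: monom_def split: if_splits\<close>)
qed

text \<open>Take \<open>A x y\<close> in \<open>min_leaves_fill\<close> to be the support of
  \<open>alpha x y\<close>. Absence of monomials in the initial ideal supplies the balancing
  hypothesis, and the branch at \<open>v\<close> consisting of \<open>lam\<close> alone, which
  contains no leaf of \<open>S\<close>, starts the argument.\<close>

lemma trop_pos_min_leaves:
  fixes T w
  defines "S \<equiv> leaves V adj - T"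
  assumes wt: "weights_ok V adj d" and ed: "edge_determinant V adj d"
    and sys: "splice_type_system V adj d alpha c g F"
    and "S \<noteq> {}" and "lam \<in> T" and "lam \<in> leaves V adj"
    and v: "v \<in> nodes V adj" and "adj lam v"
    and trop: "w \<in> trop_pos V adj F T"
  shows "leaves V adj - {lam} \<subseteq> min_leaves V adj d S w v"
proof -
  let ?Z = "min_leaves V adj d S w"
  define A where "A x y = {mu. alpha x y mu \<noteq> 0}" for x y
  have w: "w mu > 0" if "mu \<in> S" for mu
    using trop that by (auto simp: trop_pos_def S_def)
  have no_monom: "monom a \<notin> ideal_gen (conv_ring S) (initial S w ` J_tau V adj F T)"
    if "a \<in> expos S" for a
    using trop that by (auto simp: trop_pos_def S_def)
  have "finite S" using finite_leaves by (simp add: S_def)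
  have A: "A x y \<noteq> {} \<and> A x y \<subseteq> Lset V adj x y" if "x \<in> nodes V adj" "adj x y" for x y
  proof
    have y: "y \<in> nbrs adj x" using that by (simp add: nbrs_def)
    show "A x y \<subseteq> Lset V adj x y"
      using sys that(1) y by (auto simp: A_def splice_type_system_def)
    have "dv adj d x = (\<Sum>mu\<in>Lset V adj x y. alpha x y mu * ell V adj d x mu)"
      using sys that(1) y by (auto simp: splice_type_system_def)
    \<comment> \<open>Positivity of d_x rules out a constant admissible monomial.\<close>
    moreover have "dv adj d x \<noteq> 0" using dv_pos[OF wt that(1)] by simp
    ultimately obtain mu where "alpha x y mu * ell V adj d x mu \<noteq> 0"
      by (metis (mono_tags, lifting) sum.neutral)
    then show "A x y \<noteq> {}" by (auto simp: A_def)
  qed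
  have balanced: "A x y \<subseteq> ?Z x"
    if x: "x \<in> nodes V adj" "adj x e" "adj x p" "adj x y" "y \<noteq> p"
      and Z: "A x e \<subseteq> ?Z x" "\<not> A x p \<subseteq> ?Z x" for x e p y
  proof (rule ccontr)
    assume Zy: "\<not> A x y \<subseteq> ?Z x"
    obtain mu where mu: "mu \<in> ?Z x" using min_leaves_nonempty[OF \<open>finite S\<close> \<open>S \<noteq> {}\<close>] by blast
    \<comment> \<open>The minimal ratio at \<open>x\<close>: w \<ge> t w_x on \<open>S\<close>, with
      equality exactly on the minimising leaves. If the inclusion failed for both \<open>p\<close>
      and \<open>y\<close>, the one for \<open>e\<close> would yield a monomial in the initial
      ideal.\<close>
    define t where "t = w mu / real (ell V adj d x mu)"
    have pos: "real (ell V adj d x nu) > 0" for nu using ell_pos[OF wt x(1)] by simp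
    have muS: "mu \<in> S" and min: "\<And>nu. nu \<in> S \<Longrightarrow> t \<le> w nu / real (ell V adj d x nu)"
      using mu by (auto simp: min_leaves_def t_def)
    have t: "t > 0" using w[OF muS] pos by (simp add: t_def)
    have le: "t * real (ell V adj d x nu) \<le> w nu" if "nu \<in> S" for nu
      using min[OF that] pos[of nu] by (simp add: pos_le_divide_eq)
    have "nu \<in> ?Z x \<longleftrightarrow> nu \<in> S \<and> w nu / real (ell V adj d x nu) = t" for nu
      using muS min by (fastforce simp: min_leaves_def t_def)
    then have "?Z x = {nu \<in> S. w nu = t * real (ell V adj d x nu)}"
      using pos by (auto simp: divide_eq_eq)
    note Z' = Z[unfolded A_def this] Zy[unfolded A_def this]
    have n: "e \<in> nbrs adj x" "p \<in> nbrs adj x" "y \<in> nbrs adj x"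
      using x by (auto simp: nbrs_def)
    note M = monom_in_initial_ideal[OF sys x(1) n(1,2,3) x(5)[symmetric] t, of T w, folded S_def,
        OF le Z'(1,2,3)]
    show False using no_monom M by blast
  qed
  have vl: "adj v lam" using \<open>adj lam v\<close> adj_commute by blast
  have b: "branch adj v lam = {lam}"
    using branch_leaf[OF vl] \<open>lam \<in> leaves V adj\<close> by (simp add: leaves_def)
  then have disj: "?Z v \<inter> branch adj v lam = {}"
    using \<open>lam \<in> T\<close> by (auto simp: min_leaves_def S_def)
  have sub: "S \<subseteq> leaves V adj" by (auto simp: S_def)
  have "leaves V adj - branch adj v lam \<subseteq> ?Z v"
  proof (rule min_leaves_fill[where A = A, OF wt ed])
    show "A x y \<subseteq> ?Z x"
      if "x \<in> nodes V adj" "adj x e" "adj x p" "adj x y" "y \<noteq> p"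
        "A x e \<subseteq> ?Z x" "\<not> A x p \<subseteq> ?Z x" for x e p y
      by (rule balanced[OF that])
  qed (use w sub A v vl disj \<open>S \<noteq> {}\<close> in blast)+
  then show ?thesis by (simp add: b)
qed

end

section \<open>Tropicalization along a face, by dimension\<close>

theorem theorem6p13:
  fixes V :: "'v set" and adj :: "'v \<Rightarrow> 'v \<Rightarrow> bool" and d :: "'v \<Rightarrow> 'v \<Rightarrow> nat"
    and alpha :: "'v \<Rightarrow> 'v \<Rightarrow> 'v \<Rightarrow> nat" and c :: "'v \<Rightarrow> 'v \<Rightarrow> nat \<Rightarrow> complex"
    and g F :: "'v \<Rightarrow> nat \<Rightarrow> 'v pser" and T :: "'v set" and lam v :: 'v
  assumes "splice_diagram V adj"
    and "weights_ok V adj d"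
    and "edge_determinant V adj d"
    and "semigroup_cond V adj d"
    and "splice_type_system V adj d alpha c g F"
    and "T \<subseteq> leaves V adj" and "T \<noteq> {}" and "T \<noteq> leaves V adj"
    and "lam \<in> T" and "v \<in> nodes V adj" and "adj lam v"
  shows "(card T = 1 \<longrightarrow>
            trop_pos V adj F T \<subseteq> {(\<lambda>mu. r * proj_wnode V adj d T v mu) | r. r > 0}) \<and>
         (card T \<ge> 2 \<longrightarrow> trop_pos V adj F T = {})"
proof -
  interpret finite_tree V adj
    using assms(1) by unfold_locales (simp add: splice_diagram_def)
  define S where "S = leaves V adj - T"
  have "S \<noteq> {}" using assms(6,8) by (auto simp: S_def)
  have lam: "lam \<in> leaves V adj" using assms(6,9) by blast
  have min: "leaves V adj - {lam} \<subseteq> min_leaves V adj d S w v" if "w \<in> trop_pos V adj F T" for w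
    using trop_pos_min_leaves[OF assms(2,3,5) _ assms(9) lam assms(10,11) that] \<open>S \<noteq> {}\<close>
    by (simp add: S_def)
  have "card T = 1" if "w \<in> trop_pos V adj F T" for w
  proof -
    \<comment> \<open>Minimising leaves lie in \<open>S\<close>, hence outside \<open>T\<close>, yet
      they include every leaf other than \<open>lam\<close>. So a nonempty tropicalization forces
      the face to be a ray.\<close>
    have "T = {lam}" using min[OF that] assms(6,9) by (auto simp: min_leaves_def S_def)
    then show ?thesis by simp
  qed
  moreover have "\<exists>r. w = (\<lambda>mu. r * proj_wnode V adj d T v mu) \<and> r > 0"
    if trop: "w \<in> trop_pos V adj F T" for w
  proof -
    obtain nu where nu: "nu \<in> S" using \<open>S \<noteq> {}\<close> by blast
    \<comment> \<open>All leaves of \<open>S\<close> minimise the ratio, so the choice of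
      \<open>nu\<close> does not affect this common value, which is the scaling factor.\<close>
    define r where "r = w nu / real (ell V adj d v nu)"
    have pos: "real (ell V adj d v mu) > 0" for mu using ell_pos[OF assms(2,10)] by simp
    have w: "\<And>mu. mu \<in> S \<Longrightarrow> w mu > 0" "\<And>mu. mu \<notin> S \<Longrightarrow> w mu = 0"
      using trop by (auto simp: trop_pos_def S_def)
    have all: "S \<subseteq> min_leaves V adj d S w v" using min[OF trop] assms(9) by (auto simp: S_def)
    have "w mu = r * real (ell V adj d v mu)" if "mu \<in> S" for mu
    proof -
      have "mu \<in> min_leaves V adj d S w v" "nu \<in> min_leaves V adj d S w v"
        using all nu that by auto
      then have "w mu / real (ell V adj d v mu) = r"
        using nu that by (intro antisym) (simp_all add: min_leaves_def r_def)
      then show ?thesis using pos[of mu] by (simp add: divide_eq_eq)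
    qed
    then have "w = (\<lambda>mu. r * proj_wnode V adj d T v mu)"
      using w(2) by (auto simp: proj_wnode_def fun_eq_iff simp flip: S_def)
    moreover have "r > 0" using w(1)[OF nu] pos by (simp add: r_def)
    ultimately show ?thesis by blast
  qed
  ultimately show ?thesis by fastforce
qed

end
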